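(* For every positive integer $n$, $f_3(n) < \sqrt{2n} + \frac{1}{2}$.
   Context: Let $\Pi=\{\pi_1,\dots,\pi_k\}$ be a set of $k$ linear orders on a finite ground set $V$. The $k$-majority digraph of $\Pi$ has vertex set $V$ and, for distinct $u,v\in V$, an edge from $u$ to $v$ if and only if a strict majority of the $k$ linear orders rank $u$ before $v$. When $k$ is odd this digraph is a tournament, called a $k$-majority tournament. A set of vertices of a digraph $G$ is acyclic if the subgraph it induces contains no directed cycle; $a(G)$ denotes the maximum size of an acyclic set in $G$. For odd $k$ and $n\ge 1$, $f_k(n)=\min\{a(T): T \text{ is an } n\text{-vertex } k\text{-majority tournament}\}$, i.e. the minimum over all $n$-vertex $k$-majority tournaments of the maximum order of an induced transitive sub-tournament. *)

theory Defs
  imports Complex_Main "Graph_Theory.Graph_Theory"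
begin

text \<open>
  The linear orders are given as an indexed family \<open>\<pi> 0, \<dots>, \<pi> (k - 1)\<close> of reflexive linear orders
  on the ground set, so repetitions are allowed; for distinct \<open>u\<close>, \<open>v\<close>, order \<open>\<pi> i\<close> ranks \<open>u\<close> before
  \<open>v\<close> iff \<open>(u, v) \<in> \<pi> i\<close>. (With pairwise distinct orders there would be no 3-majority tournament on
  fewer than three vertices.)
\<close>

definition majority_digraph :: "nat \<Rightarrow> 'a set \<Rightarrow> (nat \<Rightarrow> 'a rel) \<Rightarrow> ('a, 'a \<times> 'a) pre_digraph" where
  "majority_digraph k V \<pi> = with_proj
     \<lparr> pverts = V,
       parcs = {(u, v). u \<in> V \<and> v \<in> V \<and> u \<noteq> v \<and> 2 * card {i. i < k \<and> (u, v) \<in> \<pi> i} > k} \<rparr>"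

definition k_majority_tournament :: "nat \<Rightarrow> ('a, 'a \<times> 'a) pre_digraph \<Rightarrow> bool" where
  "k_majority_tournament k T \<longleftrightarrow>
     odd k \<and>
     (\<exists>V \<pi>. finite V \<and> (\<forall>i<k. linear_order_on V (\<pi> i)) \<and> T = majority_digraph k V \<pi>)"

definition acyclic_set :: "('a, 'b) pre_digraph \<Rightarrow> 'a set \<Rightarrow> bool" where
  "acyclic_set G S \<longleftrightarrow> S \<subseteq> verts G \<and> (\<nexists>p. pre_digraph.cycle (G \<restriction> S) p)"

definition max_acyclic :: "('a, 'b) pre_digraph \<Rightarrow> nat" where
  "max_acyclic G = Max {card S | S. acyclic_set G S}"

text \<open>
  Vertices are taken in \<^typ>\<open>nat\<close>; this loses nothing, since every finite digraph has an
  isomorphic copy there.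
\<close>

definition f_majority :: "nat \<Rightarrow> nat \<Rightarrow> nat" where
  "f_majority k n = Min {max_acyclic T | T :: (nat, nat \<times> nat) pre_digraph.
     k_majority_tournament k T \<and> card (verts T) = n}"

text \<open>
  For odd \<open>k\<close> the majority digraph is a tournament, and the sets whose maximum and minimum are taken
  above are finite and nonempty.
\<close>

lemma k_majority_tournament_arcs:
  assumes "k_majority_tournament k T" "u \<in> verts T" "v \<in> verts T" "u \<noteq> v"
  shows "(u, v) \<in> arcs T \<longleftrightarrow> (v, u) \<notin> arcs T"
proof -
  from assms(1) obtain V \<pi> where k: "odd k" and lin: "\<And>i. i < k \<Longrightarrow> linear_order_on V (\<pi> i)"
    and T: "T = majority_digraph k V \<pi>"
    unfolding k_majority_tournament_def by blast
  have uv: "u \<in> V" "v \<in> V" using assms(2,3) T by (auto simp: majority_digraph_def)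
  let ?A = "{i. i < k \<and> (u, v) \<in> \<pi> i}" and ?B = "{i. i < k \<and> (v, u) \<in> \<pi> i}"
  have "?A \<union> ?B = {..<k}"
  proof -
    have "(u, v) \<in> \<pi> i \<or> (v, u) \<in> \<pi> i" if "i < k" for i
      using lin[OF that] uv \<open>u \<noteq> v\<close> by (simp add: linear_order_on_def total_on_def)
    then show ?thesis by auto
  qed
  moreover have "?A \<inter> ?B = {}"
  proof -
    have "\<not> ((u, v) \<in> \<pi> i \<and> (v, u) \<in> \<pi> i)" if "i < k" for i
      using lin[OF that] \<open>u \<noteq> v\<close> by (auto simp: order_on_defs dest: antisymD)
    then show ?thesis by auto
  qed
  ultimately have "card ?A + card ?B = k"
    using card_Un_disjoint[of ?A ?B] by simp
  with k have "2 * card ?A > k \<longleftrightarrow> \<not> 2 * card ?B > k" by presburger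
  then show ?thesis using uv \<open>u \<noteq> v\<close> by (auto simp: T majority_digraph_def)
qed

lemma finite_acyclic_cards:
  assumes "finite (verts G)"
  shows "finite {card S | S. acyclic_set G S}" "{card S | S. acyclic_set G S} \<noteq> {}"
proof -
  have "{card S | S. acyclic_set G S} \<subseteq> card ` Pow (verts G)"
    by (auto simp: acyclic_set_def)
  then show "finite {card S | S. acyclic_set G S}"
    by (rule finite_subset) (simp add: assms)
  have "acyclic_set G {}"
    by (auto simp: acyclic_set_def pre_digraph.cycle_def pre_digraph.awalk_def)
  then show "{card S | S. acyclic_set G S} \<noteq> {}" by blast
qed

lemma finite_f_majority_set:
  assumes "n \<ge> 1"
  shows "finite {max_acyclic T | T :: (nat, nat \<times> nat) pre_digraph.
           k_majority_tournament k T \<and> card (verts T) = n}"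
proof (rule finite_subset)
  show "{max_acyclic T | T :: (nat, nat \<times> nat) pre_digraph.
           k_majority_tournament k T \<and> card (verts T) = n} \<subseteq> {..n}"
  proof clarsimp
    fix T :: "(nat, nat \<times> nat) pre_digraph"
    assume "k_majority_tournament k T" and n: "n = card (verts T)"
    have fin: "finite (verts T)" using n assms by (metis card.infinite not_one_le_zero)
    have "max_acyclic T \<in> {card S | S. acyclic_set T S}"
      unfolding max_acyclic_def by (intro Max_in finite_acyclic_cards fin)
    then show "max_acyclic T \<le> card (verts T)"
      using fin by (auto simp: acyclic_set_def intro: card_mono)
  qed
qed simp

lemma f_majority_set_nonempty:
  assumes "odd k"
  shows "{max_acyclic T | T :: (nat, nat \<times> nat) pre_digraph.
           k_majority_tournament k T \<and> card (verts T) = n} \<noteq> {}"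
proof -
  let ?r = "{(u, v). u < n \<and> v < n \<and> u \<le> v}"
  have "linear_order_on {..<n} ?r"
    using natLeq_on_Well_order[of n] by (simp add: Field_natLeq_on well_order_on_def lessThan_def)
  then have "k_majority_tournament k (majority_digraph k {..<n} (\<lambda>_. ?r))"
    unfolding k_majority_tournament_def
    by (intro conjI assms exI[of _ "{..<n}"] exI[of _ "\<lambda>_. ?r"]) simp_all
  moreover have "card (verts (majority_digraph k {..<n} (\<lambda>_. ?r))) = n"
    by (simp add: majority_digraph_def)
  ultimately have "max_acyclic (majority_digraph k {..<n} (\<lambda>_. ?r)) \<in>
      {max_acyclic T | T :: (nat, nat \<times> nat) pre_digraph. k_majority_tournament k T \<and> card (verts T) = n}"
    by (intro CollectI exI[of _ "majority_digraph k {..<n} (\<lambda>_. ?r)"] conjI refl)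
  then show ?thesis by (metis (no_types) empty_iff)
qed

end

theory Submission
  imports Defs
begin

text \<open>
  Let \<open>k\<close> be least with \<open>n \<le> k (k + 1) / 2\<close>, and take \<open>n\<close> lattice points of the triangle
  \<open>a + b + c = k - 1\<close>, \<open>a, b, c \<ge> 0\<close>. Order them by decreasing \<open>a\<close>, \<open>b\<close>, \<open>c\<close> respectively, breaking
  ties by \<open>b\<close>, \<open>c\<close>, \<open>a\<close>. Then the points beating a given \<open>t\<close> fill three alternating half-open
  sectors of angle 60 degrees at \<open>t\<close>. An acyclic set contained in a triangle with \<open>m\<close> points per side
  has at most \<open>m\<close> points: delete its sink \<open>t\<close>; the three sectors cut the triangle in smaller ones,
  whose side lengths add up to \<open>m - 1\<close>.
\<close>

definition lex_order :: "'a set \<Rightarrow> ('a \<Rightarrow> nat) \<Rightarrow> ('a \<Rightarrow> nat) \<Rightarrow> 'a rel" where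
  "lex_order V f g = {(u, v). u \<in> V \<and> v \<in> V \<and> (f v < f u \<or> f v = f u \<and> g v \<le> g u)}"

lemma linear_order_on_lex_order:
  assumes "\<And>u v. u \<in> V \<Longrightarrow> v \<in> V \<Longrightarrow> f u = f v \<Longrightarrow> g u = g v \<Longrightarrow> u = v"
  shows "linear_order_on V (lex_order V f g)"
  unfolding order_on_defs refl_on_def trans_def antisym_def total_on_def lex_order_def
  using assms by (auto intro: le_antisym)

lemma majority_of_three:
  "3 < 2 * card {i. i < (3::nat) \<and> P i} \<longleftrightarrow> P 0 \<and> P 1 \<or> P 1 \<and> P 2 \<or> P 2 \<and> P 0"
proof -
  have "{i. i < (3::nat) \<and> P i} = {..<3} \<inter> {i. P i}" by auto
  then have "card {i. i < (3::nat) \<and> P i} = (\<Sum>i<3. of_bool (P i))" by simp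
  then show ?thesis by (simp add: numeral_3_eq_3 numeral_2_eq_2)
qed

text \<open>This is the majority relation of the three lexicographic orders on points with constant
  \<open>a + b + c\<close>. Each disjunct is one pair of agreeing orders, and geometrically one of
  the three sectors at \<open>v\<close>.\<close>

definition sector_dominates ::
    "('a \<Rightarrow> nat) \<Rightarrow> ('a \<Rightarrow> nat) \<Rightarrow> ('a \<Rightarrow> nat) \<Rightarrow> 'a \<Rightarrow> 'a \<Rightarrow> bool" where
  "sector_dominates a b c u v \<longleftrightarrow>
     a v \<le> a u \<and> b v < b u \<or> b v \<le> b u \<and> c v < c u \<or> c v \<le> c u \<and> a v < a u"

text \<open>The numbers \<alpha>, \<beta>, \<gamma> bound the coordinates from below, so the
  triangle has \<open>s + 1 - \<alpha> - \<beta> - \<gamma>\<close> points per side; the additive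
  form avoids truncated subtraction. A sink is demanded of every nonempty subset so that the sectors
  inherit the hypothesis. The last assumption admits side length 0, which an empty sector can
  have.\<close>

lemma card_le_triangle_side:
  fixes a b c :: "'a \<Rightarrow> nat"
  assumes "finite S"
    and "\<And>Q. Q \<subseteq> S \<Longrightarrow> Q \<noteq> {} \<Longrightarrow> \<exists>t\<in>Q. \<forall>u\<in>Q - {t}. sector_dominates a b c u t"
    and "\<And>v. v \<in> S \<Longrightarrow> \<alpha> \<le> a v \<and> \<beta> \<le> b v \<and> \<gamma> \<le> c v \<and> a v + b v + c v = s"
    and "\<alpha> + \<beta> + \<gamma> \<le> s + 1"
  shows "card S + \<alpha> + \<beta> + \<gamma> \<le> s + 1"
  using assms
proof (induction "card S" arbitrary: S \<alpha> \<beta> \<gamma> rule: less_induct)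
  case less
  note sinks = less.prems(2) and tri = less.prems(3)
  show ?case
  proof (cases "S = {}")
    case True
    then show ?thesis using less.prems(4) by simp
  next
    case False
    obtain t where t: "t \<in> S" and dom: "\<forall>u\<in>S - {t}. sector_dominates a b c u t"
      using sinks[OF order_refl False] by blast
    note tt = tri[OF t]
    define A where "A = {u \<in> S. a t \<le> a u \<and> b t < b u}"
    define B where "B = {u \<in> S. b t \<le> b u \<and> c t < c u}"
    define C where "C = {u \<in> S. c t \<le> c u \<and> a t < a u}"
    note fin = \<open>finite S\<close>
    have sub: "A \<subset> S" "B \<subset> S" "C \<subset> S"
      using t by (auto simp: A_def B_def C_def)
    then have small: "card A < card S" "card B < card S" "card C < card S"
      and fins: "finite A" "finite B" "finite C"
      using fin by (auto intro: psubset_card_mono finite_subset)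
    \<comment> \<open>The sector \<open>A\<close> lies in the triangle with lower bounds
      \<open>a t\<close>, \<open>b t + 1\<close>, \<gamma>, whose side is
      \<open>c t - \<gamma>\<close>. Likewise \<open>B\<close> and \<open>C\<close> get sides
      \<open>a t - \<alpha>\<close> and \<open>b t - \<beta>\<close>.\<close>
    have "card A + a t + (b t + 1) + \<gamma> \<le> s + 1"
      using small(1) fins(1)
    proof (rule less.hyps)
      show "\<exists>x\<in>Q. \<forall>u\<in>Q - {x}. sector_dominates a b c u x" if "Q \<subseteq> A" "Q \<noteq> {}" for Q
        using sinks[of Q] that sub by blast
    qed (use tri tt in \<open>auto simp: A_def\<close>)
    moreover have "card B + \<alpha> + b t + (c t + 1) \<le> s + 1"
      using small(2) fins(2)
    proof (rule less.hyps)
      show "\<exists>x\<in>Q. \<forall>u\<in>Q - {x}. sector_dominates a b c u x" if "Q \<subseteq> B" "Q \<noteq> {}" for Q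
        using sinks[of Q] that sub by blast
    qed (use tri tt in \<open>auto simp: B_def\<close>)
    moreover have "card C + (a t + 1) + \<beta> + c t \<le> s + 1"
      using small(3) fins(3)
    proof (rule less.hyps)
      show "\<exists>x\<in>Q. \<forall>u\<in>Q - {x}. sector_dominates a b c u x" if "Q \<subseteq> C" "Q \<noteq> {}" for Q
        using sinks[of Q] that sub by blast
    qed (use tri tt in \<open>auto simp: C_def\<close>)
    moreover have "card S \<le> card A + card B + card C + 1"
    proof -
      have "S \<subseteq> insert t (A \<union> B \<union> C)"
        using dom by (auto simp: A_def B_def C_def sector_dominates_def)
      then have "card S \<le> card (insert t (A \<union> B \<union> C))"
        using fins by (intro card_mono) auto
      also have "\<dots> \<le> Suc (card (A \<union> B \<union> C))"
        by (rule card_insert_le_m1[THEN le_trans]) auto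
      also have "card (A \<union> B \<union> C) \<le> card A + card B + card C"
        by (meson add_mono card_Un_le le_refl le_trans)
      finally show ?thesis by simp
    qed
    \<comment> \<open>Since \<open>a t + b t + c t = s\<close>, the three sides add up to
      \<open>s - \<alpha> - \<beta> - \<gamma>\<close>, and \<open>t\<close> itself contributes the
      missing 1.\<close>
    ultimately show ?thesis using tt by linarith
  qed
qed

lemma verts_majority_digraph [simp]: "verts (majority_digraph k V \<pi>) = V"
  by (simp add: majority_digraph_def)

lemma acyclic_set_no_triangle:
  assumes acy: "acyclic_set (majority_digraph k V \<pi>) S"
    and S: "u \<in> S" "v \<in> S" "w \<in> S"
    and arcs: "(u, v) \<in> arcs (majority_digraph k V \<pi>)" "(v, w) \<in> arcs (majority_digraph k V \<pi>)"
      "(w, u) \<in> arcs (majority_digraph k V \<pi>)"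
  shows False
proof -
  have "pre_digraph.cycle (majority_digraph k V \<pi> \<restriction> S) [(u, v), (v, w), (w, u)]"
    unfolding pre_digraph.cycle_def pre_digraph.awalk_def using S arcs
    by (auto simp: majority_digraph_def pre_digraph.cas.simps pre_digraph.awalk_verts.simps
        intro!: exI[of _ u])
  then show False using acy by (auto simp: acyclic_set_def)
qed

text \<open>In a tournament without directed triangles the arcs form a transitive relation, hence a
  strict order, and a finite nonempty set has an extremal element.\<close>

lemma acyclic_set_has_sink:
  assumes T: "k_majority_tournament k T" and acy: "acyclic_set T S"
    and Q: "Q \<subseteq> S" "Q \<noteq> {}"
  shows "\<exists>t\<in>Q. \<forall>u\<in>Q - {t}. (u, t) \<in> arcs T"
proof -
  from T obtain V \<pi> where "finite V" and TV: "T = majority_digraph k V \<pi>"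
    unfolding k_majority_tournament_def by blast
  have SV: "S \<subseteq> verts T" using acy by (simp add: acyclic_set_def)
  then have "finite Q" using Q(1) \<open>finite V\<close> TV by (metis finite_subset verts_majority_digraph)
  have irr: "(u, u) \<notin> arcs T" for u by (simp add: TV majority_digraph_def)
  \<comment> \<open>The arcs are reversed so that an \<open>R\<close>-minimal element is a
    sink.\<close>
  define R where "R = {(u, v). u \<in> Q \<and> v \<in> Q \<and> (v, u) \<in> arcs T}"
  have "trans R"
  proof (rule transI)
    fix x y z assume xy: "(x, y) \<in> R" and yz: "(y, z) \<in> R"
    have arcs: "(z, y) \<in> arcs T" "(y, x) \<in> arcs T" and xyz: "x \<in> Q" "y \<in> Q" "z \<in> Q"
      using xy yz by (auto simp: R_def)
    have "(x, z) \<notin> arcs T"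
      using acyclic_set_no_triangle[of k V \<pi> S z y x] acy arcs xyz Q(1) TV by auto
    moreover have "x \<noteq> z"
      using k_majority_tournament_arcs[OF T, of x y] arcs xyz Q(1) SV irr by auto
    ultimately show "(x, z) \<in> R"
      using k_majority_tournament_arcs[OF T, of x z] xyz Q(1) SV by (auto simp: R_def)
  qed
  then have "acyclic R"
    using irr by (auto simp: acyclic_irrefl irrefl_def R_def)
  moreover have "finite R"
    by (rule finite_subset[of _ "Q \<times> Q"]) (use \<open>finite Q\<close> in \<open>auto simp: R_def\<close>)
  ultimately have "wf R" by (intro finite_acyclic_wf)
  moreover obtain q where "q \<in> Q" using Q(2) by blast
  ultimately obtain t where t: "t \<in> Q" "\<And>u. (u, t) \<in> R \<Longrightarrow> u \<notin> Q"
    by (rule wfE_min) blast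
  have "(u, t) \<in> arcs T" if u: "u \<in> Q - {t}" for u
  proof -
    have "(t, u) \<notin> arcs T" using t(1) t(2)[of u] u by (auto simp: R_def)
    then show ?thesis using k_majority_tournament_arcs[OF T, of t u] t(1) u Q(1) SV by blast
  qed
  with t(1) show ?thesis by blast
qed

text \<open>This reduces the upper bound to placing the vertices injectively in a triangle of
  lattice points with \<open>s + 1\<close> points per side.\<close>

lemma max_acyclic_cyclic_lex_orders:
  fixes a b c :: "'a \<Rightarrow> nat"
  assumes "finite V"
    and sum: "\<And>v. v \<in> V \<Longrightarrow> a v + b v + c v = s"
    and inj: "\<And>u v. u \<in> V \<Longrightarrow> v \<in> V \<Longrightarrow> a u = a v \<Longrightarrow> b u = b v \<Longrightarrow> u = v"
  obtains \<pi> where "k_majority_tournament 3 (majority_digraph 3 V \<pi>)"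
    and "max_acyclic (majority_digraph 3 V \<pi>) \<le> s + 1"
proof
  define \<pi> where "\<pi> = (\<lambda>i::nat. if i = 0 then lex_order V a b
    else if i = 1 then lex_order V b c else lex_order V c a)"
  let ?T = "majority_digraph 3 V \<pi>"
  \<comment> \<open>The constant sum makes any two of the three coordinates determine the
    point.\<close>
  have inj': "u = v" if "u \<in> V" "v \<in> V" "b u = b v \<and> c u = c v \<or> c u = c v \<and> a u = a v" for u v
    using sum[OF that(1)] sum[OF that(2)] that inj by fastforce
  have "linear_order_on V (\<pi> i)" for i
    unfolding \<pi>_def using inj inj' by (auto intro!: linear_order_on_lex_order)
  then show T: "k_majority_tournament 3 ?T"
    unfolding k_majority_tournament_def using \<open>finite V\<close>
    by (intro conjI exI[of _ V] exI[of _ \<pi>]) auto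
  have dom: "sector_dominates a b c u v" if "(u, v) \<in> arcs ?T" for u v
  proof -
    have uv: "u \<in> V" "v \<in> V" "u \<noteq> v"
      and maj: "(u, v) \<in> \<pi> 0 \<and> (u, v) \<in> \<pi> 1 \<or> (u, v) \<in> \<pi> 1 \<and> (u, v) \<in> \<pi> 2 \<or>
        (u, v) \<in> \<pi> 2 \<and> (u, v) \<in> \<pi> 0"
      using that majority_of_three[of "\<lambda>i. (u, v) \<in> \<pi> i"] by (auto simp: majority_digraph_def)
    \<comment> \<open>Two agreeing orders make two coordinates of \<open>u\<close> at least those of
      \<open>v\<close>. If the one required to be strictly larger were tied, the tie-break would
      bound the third coordinate as well, and the constant sum would force
      \<open>u = v\<close>.\<close>
    have "\<not> (a u = a v \<and> b u = b v)" using inj uv by blast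
    then show ?thesis
      using maj sum[OF uv(1)] sum[OF uv(2)] unfolding \<pi>_def lex_order_def sector_dominates_def
      by simp linarith
  qed
  have "card S \<le> s + 1" if S: "acyclic_set ?T S" for S
  proof -
    have SV: "S \<subseteq> V" using S by (simp add: acyclic_set_def)
    then have "finite S" using \<open>finite V\<close> by (rule finite_subset)
    then have "card S + 0 + 0 + 0 \<le> s + 1"
    proof (rule card_le_triangle_side)
      show "\<exists>t\<in>Q. \<forall>u\<in>Q - {t}. sector_dominates a b c u t" if "Q \<subseteq> S" "Q \<noteq> {}" for Q
        using acyclic_set_has_sink[OF T S that] dom by blast
    qed (use sum SV in auto)
    then show ?thesis by simp
  qed
  then show "max_acyclic ?T \<le> s + 1"
    using finite_acyclic_cards[of ?T] \<open>finite V\<close> unfolding max_acyclic_def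
    by (subst Max_le_iff) auto
qed

lemma card_triangle: "2 * card {(x, y). x + y < (k::nat)} = k * (k + 1)"
proof -
  have "{(x, y). x + y < k} = (SIGMA x:{..<k}. {..<k - x})" by auto
  then have "card {(x, y). x + y < k} = (\<Sum>x<k. k - x)" by simp
  also have "\<dots> = (\<Sum>x<k. Suc x)"
    by (subst sum.nat_diff_reindex[symmetric]) (auto intro!: sum.cong)
  also have "2 * \<dots> = k * (k + 1)" by (induction k) auto
  finally show ?thesis .
qed

lemma f_majority_3_le:
  assumes "1 \<le> n" "2 * n \<le> k * (k + 1)"
  shows "f_majority 3 n \<le> k"
proof -
  have k: "k \<ge> 1" using assms by (cases k) auto
  \<comment> \<open>These are the lattice points of the triangle with the third coordinate dropped;
    it is recovered as \<open>k - 1 - x - y\<close>, where \<open>x + y < k\<close> keeps the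
    subtraction exact.\<close>
  let ?P = "{(x, y). x + y < k}"
  have "finite ?P" by (rule finite_subset[of _ "{..<k} \<times> {..<k}"]) auto
  moreover have "card {..<n} \<le> card ?P" using assms(2) card_triangle[of k] by simp
  ultimately obtain e where e: "e ` {..<n} \<subseteq> ?P" "inj_on e {..<n}"
    using card_le_inj[of "{..<n}" ?P] by auto
  define a b where "a = fst \<circ> e" and "b = snd \<circ> e"
  define c where "c v = k - 1 - a v - b v" for v
  obtain \<pi> where T: "k_majority_tournament 3 (majority_digraph 3 {..<n} \<pi>)"
    and le: "max_acyclic (majority_digraph 3 {..<n} \<pi>) \<le> k - 1 + 1"
  proof (rule max_acyclic_cyclic_lex_orders[of "{..<n}" a b c "k - 1"])
    show "a v + b v + c v = k - 1" if "v \<in> {..<n}" for v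
    proof -
      have "e v \<in> ?P" by (rule subsetD[OF e(1) imageI[OF that]])
      then show ?thesis by (auto simp: a_def b_def c_def)
    qed
    show "u = v" if "u \<in> {..<n}" "v \<in> {..<n}" "a u = a v" "b u = b v" for u v
      using that e(2) by (auto simp: a_def b_def inj_on_def prod_eq_iff)
  qed auto
  have "f_majority 3 n \<le> max_acyclic (majority_digraph 3 {..<n} \<pi>)"
    unfolding f_majority_def
  proof (rule Min_le[OF finite_f_majority_set[OF assms(1)]], intro CollectI exI conjI)
    show "k_majority_tournament 3 (majority_digraph 3 {..<n} \<pi>)" by (rule T)
  qed simp_all
  with le k show ?thesis by simp
qed

theorem theorem2p3:
  fixes n :: nat
  assumes "n \<ge> 1"
  shows "real (f_majority 3 n) < sqrt (2 * real n) + 1 / 2"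
proof -
  define k where "k = (LEAST k. 2 * n \<le> k * (k + 1))"
  have k: "2 * n \<le> k * (k + 1)"
    unfolding k_def by (rule LeastI[of _ "2 * n"]) simp
  with assms obtain j where j: "k = Suc j" by (cases k) auto
  then have "\<not> 2 * n \<le> j * (j + 1)"
    using not_less_Least[of j "\<lambda>k. 2 * n \<le> k * (k + 1)"] unfolding k_def by simp
  \<comment> \<open>With \<open>k = j + 1\<close>, the square of \<open>k - 1/2\<close> is
    \<open>j * (j + 1) + 1/4\<close>, so the integer gap of 1 gives the strict inequality.\<close>
  then have "j * (j + 1) + 1 \<le> 2 * n" by simp
  then have "real (j * (j + 1) + 1) \<le> real (2 * n)" by (rule of_nat_mono)
  then have "(real k - 1 / 2)\<^sup>2 < 2 * real n"
    by (simp add: j power2_eq_square algebra_simps)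
  then have "real k - 1 / 2 < sqrt (2 * real n)" by (rule real_less_rsqrt)
  with f_majority_3_le[OF assms k] show ?thesis by linarith
qed

end
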